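(* Let $p$ be a prime and let $q=p^k$ for some integer $k\geq 1$. Then there exists a transitive permutation group $G_q$ of degree $q(q+1)$ such that the derangement graph $\Gamma_{G_q}$ is a complete $(q+1)$-partite graph.
   Context: For a finite transitive permutation group $G\leq \mathrm{Sym}(\Omega)$, a derangement is an element of $G$ with no fixed point on $\Omega$. The derangement graph $\Gamma_G$ is the Cayley graph $\mathrm{Cay}(G,\mathrm{Der}(G))$, where $\mathrm{Der}(G)$ is the set of derangements of $G$; equivalently, its vertex set is $G$ and $\sigma,\pi\in G$ are adjacent iff $\omega^\sigma\neq\omega^\pi$ for every $\omega\in\Omega$. *)

theory Defs
  imports
    "HOL-Algebra.Group_Action"
    "HOL-Computational_Algebra.Primes"
    "HOL-Library.Disjoint_Sets"
    "Graph_Theory.Graph_Theory"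
begin

text \<open>\<open>H\<close> is the underlying set of the group; the operation is the one of \<open>BijGroup \<Omega>\<close>, whose
  elements are the bijections of \<open>\<Omega>\<close> that are \<open>undefined\<close> outside \<open>\<Omega>\<close>.\<close>

definition perm_group :: "'a set \<Rightarrow> ('a \<Rightarrow> 'a) set \<Rightarrow> ('a \<Rightarrow> 'a) monoid" where
  "perm_group \<Omega> H = (BijGroup \<Omega>)\<lparr>carrier := H\<rparr>"

definition transitive_permutation_group :: "'a set \<Rightarrow> ('a \<Rightarrow> 'a) set \<Rightarrow> bool" where
  "transitive_permutation_group \<Omega> H \<longleftrightarrow>
     finite \<Omega> \<and> subgroup H (BijGroup \<Omega>) \<and> transitive_action (perm_group \<Omega> H) \<Omega> (\<lambda>g. g)"

definition derangements :: "'a set \<Rightarrow> ('a \<Rightarrow> 'a) set \<Rightarrow> ('a \<Rightarrow> 'a) set" where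
  "derangements \<Omega> H = {g \<in> H. \<forall>\<omega>\<in>\<Omega>. g \<omega> \<noteq> \<omega>}"

text \<open>Arcs run from \<open>x\<close> to \<open>s \<otimes> x\<close>. For a connection set closed under conjugation, such as the
  set of derangements, the convention \<open>x \<otimes> s\<close> gives the same graph.\<close>

definition cayley_graph :: "('g, 'm) monoid_scheme \<Rightarrow> 'g set \<Rightarrow> 'g pair_pre_digraph" where
  "cayley_graph G S =
     \<lparr>pverts = carrier G, parcs = {(x, s \<otimes>\<^bsub>G\<^esub> x) | x s. x \<in> carrier G \<and> s \<in> S}\<rparr>"

definition derangement_graph :: "'a set \<Rightarrow> ('a \<Rightarrow> 'a) set \<Rightarrow> ('a \<Rightarrow> 'a) pair_pre_digraph" where
  "derangement_graph \<Omega> H = cayley_graph (perm_group \<Omega> H) (derangements \<Omega> H)"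

text \<open>The parts are nonempty, as \<open>partition_on\<close> excludes the empty block.\<close>

definition complete_multipartite :: "nat \<Rightarrow> ('a, 'b) pre_digraph \<Rightarrow> bool" where
  "complete_multipartite m \<Gamma> \<longleftrightarrow> graph \<Gamma> \<and>
     (\<exists>P. partition_on (verts \<Gamma>) P \<and> card P = m \<and>
        arcs_ends \<Gamma> = {(u, v). u \<in> verts \<Gamma> \<and> v \<in> verts \<Gamma> \<and> \<not> (\<exists>B\<in>P. u \<in> B \<and> v \<in> B)})"

end

theory Submission
  imports Defs "HOL-Algebra.Algebraic_Closure" "HOL-Number_Theory.Residues"
begin

hide_const (open) Divisibility.prime

text \<open>Take fields \<open>K \<subseteq> F\<close> of orders \<open>q\<close> and \<open>q\<^sup>2\<close>, and let the one-dimensional affine group of \<open>F\<close>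
  act on the \<open>q (q + 1)\<close> lines of \<open>F\<close>, viewed as the affine plane over \<open>K\<close>; the stabilizer of the
  line \<open>K\<close> is the affine group of \<open>K\<close>. If \<open>a \<in> K\<close>, then \<open>x \<mapsto> a x + b\<close> fixes a line: a line in
  direction \<open>b\<close> if \<open>a = 1\<close>, and a line through its fixed point otherwise. If \<open>a \<notin> K\<close>, it moves every
  direction. So the elements that are not derangements form a subgroup, of index \<open>q + 1\<close>, and two
  elements are adjacent in the derangement graph iff they lie in different cosets of it.\<close>

section \<open>Coset actions in which the non-derangements form a subgroup\<close>

text \<open>In the action of \<open>G\<close> on the left cosets of \<open>H\<close>,
  \<open>g\<close> fixes \<open>x H\<close> iff \<open>g \<otimes> x = x \<otimes> h\<close> for
  some \<open>h \<in> H\<close>. So \<open>conj\<close> says that \<open>N\<close> consists of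
  exactly the elements with a fixed point, and the parts are the images of the right cosets of
  \<open>N\<close>. The action need not be faithful, but its kernel lies in \<open>N\<close>, so
  these images stay disjoint.\<close>

lemma (in group) coset_action_complete_multipartite:
  assumes fin: "finite (carrier G)" and H: "subgroup H G" and N: "subgroup N G"
    and conj: "\<And>g. g \<in> carrier G \<Longrightarrow>
      g \<in> N \<longleftrightarrow> (\<exists>x\<in>carrier G. \<exists>h\<in>H. g \<otimes> x = x \<otimes> h)"
  shows "\<exists>(\<Omega> :: nat set) K. transitive_permutation_group \<Omega> K \<and> card \<Omega> = card (rcosets H) \<and>
    complete_multipartite (card (rcosets N)) (with_proj (derangement_graph \<Omega> K))"
proof -
  interpret H: subgroup H G by (rule H)
  interpret N: subgroup N G by (rule N)
  have coset_eq: "S #> x = S #> y \<longleftrightarrow> x \<otimes> inv y \<in> S"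
    if S: "subgroup S G" and x: "x \<in> carrier G" and y: "y \<in> carrier G" for S x y
  proof
    assume "S #> x = S #> y"
    then have "x \<in> S #> y" using rcos_self[OF x S] by simp
    then show "x \<otimes> inv y \<in> S" by (rule subgroup.rcos_module_imp[OF S is_group y])
  next
    assume "x \<otimes> inv y \<in> S"
    then have "x \<in> S #> y" by (rule subgroup.rcos_module_rev[OF S is_group y x])
    then show "S #> x = S #> y" using repr_independence[OF _ y S] by simp
  qed

  \<comment> \<open>The action of \<open>G\<close> on the left cosets of \<open>H\<close>\<close>
  have "finite (rcosets H)"
    using fin rcosets_subset_PowG[OF H] by (meson finite_Pow_iff finite_subset)
  \<comment> \<open>Numbering the cosets turns the points into natural numbers, the point type of
    the conclusion.\<close>
  then obtain l where l: "bij_betw l (rcosets H) {0..<card (rcosets H)}"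
    using ex_bij_betw_finite_nat by blast
  define \<Omega> where "\<Omega> = {0..<card (rcosets H)}"
  \<comment> \<open>The left coset \<open>x H\<close> is named by the right coset \<open>H x\<^sup>-\<^sup>1\<close>, since the library counts right cosets.\<close>
  define r where "r x = l (H #> inv x)" for x
  have r_eq: "r x = r y \<longleftrightarrow> inv x \<otimes> y \<in> H" if "x \<in> carrier G" "y \<in> carrier G" for x y
  proof -
    have "r x = r y \<longleftrightarrow> H #> inv x = H #> inv y"
      unfolding r_def using l that by (auto simp: bij_betw_def inj_on_eq_iff rcosetsI H.subset)
    then show ?thesis using that coset_eq[OF H] by simp
  qed
  have r_img: "r ` carrier G = \<Omega>"
  proof -
    have "(\<lambda>x. H #> inv x) ` carrier G = (rcosets H)"
      unfolding RCOSETS_def by (auto simp: image_iff) (metis inv_closed inv_inv)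
    then have "r ` carrier G = l ` (rcosets H)"
      unfolding r_def by (metis image_image)
    then show ?thesis using l by (simp add: bij_betw_def \<Omega>_def)
  qed
  \<comment> \<open>Left multiplication on cosets, computed through a chosen representative;
    \<open>\<psi>_r\<close> shows that the choice does not matter. The restriction leaves
    \<open>\<psi> g\<close> undefined outside \<open>\<Omega>\<close>, as membership in
    \<open>Bij \<Omega>\<close> requires.\<close>
  define \<psi> where "\<psi> g = (\<lambda>n\<in>\<Omega>. r (g \<otimes> inv_into (carrier G) r n))" for g
  have \<psi>_r: "\<psi> g (r x) = r (g \<otimes> x)" if g: "g \<in> carrier G" and x: "x \<in> carrier G" for g x
  proof -
    define s where "s = inv_into (carrier G) r (r x)"
    have s: "s \<in> carrier G" "r s = r x"
      unfolding s_def using x by (auto intro: inv_into_into f_inv_into_f)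
    have "inv (g \<otimes> s) \<otimes> (g \<otimes> x) = inv s \<otimes> x"
      using g x s(1) by (simp add: inv_mult_group m_assoc inv_solve_left')
    then have "r (g \<otimes> s) = r (g \<otimes> x)"
      using s x g r_eq by simp
    then show ?thesis
      unfolding \<psi>_def using r_img x by (auto simp: s_def)
  qed
  have \<psi>_comp: "compose \<Omega> (\<psi> g) (\<psi> h) = \<psi> (g \<otimes> h)" if "g \<in> carrier G" "h \<in> carrier G" for g h
  proof
    fix n show "compose \<Omega> (\<psi> g) (\<psi> h) n = \<psi> (g \<otimes> h) n"
    proof (cases "n \<in> \<Omega>")
      case True
      then obtain x where "x \<in> carrier G" "n = r x" using r_img by auto
      then show ?thesis using that True by (simp add: compose_def \<psi>_r m_assoc)
    qed (simp add: compose_def \<psi>_def)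
  qed
  have \<psi>_one: "\<psi> \<one> = (\<lambda>n\<in>\<Omega>. n)"
  proof
    fix n show "\<psi> \<one> n = (\<lambda>n\<in>\<Omega>. n) n"
    proof (cases "n \<in> \<Omega>")
      case True
      then obtain x where "x \<in> carrier G" "n = r x" using r_img by auto
      then show ?thesis using True by (simp add: \<psi>_r)
    qed (simp add: \<psi>_def)
  qed
  have \<psi>_into: "\<psi> g n \<in> \<Omega>" if "g \<in> carrier G" "n \<in> \<Omega>" for g n
  proof -
    obtain x where "x \<in> carrier G" "n = r x" using r_img \<open>n \<in> \<Omega>\<close> by auto
    then show ?thesis using that r_img by (auto simp: \<psi>_r)
  qed
  have \<psi>_cancel: "\<psi> (inv g) (\<psi> g n) = n" if "g \<in> carrier G" "n \<in> \<Omega>" for g n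
    using fun_cong[OF \<psi>_comp[of "inv g" g], of n] that by (simp add: compose_def \<psi>_one)
  have \<psi>_Bij: "\<psi> g \<in> Bij \<Omega>" if g: "g \<in> carrier G" for g
  proof -
    have "bij_betw (\<psi> g) \<Omega> \<Omega>"
      using \<psi>_cancel[of g] \<psi>_cancel[of "inv g"] \<psi>_into[of g] \<psi>_into[of "inv g"] g
      by (intro bij_betwI[where g = "\<psi> (inv g)"]) auto
    then show ?thesis by (simp add: Bij_def \<psi>_def)
  qed
  have hom: "group_hom G (BijGroup \<Omega>) \<psi>"
    using group_BijGroup \<psi>_Bij \<psi>_comp
    by (auto intro!: group_hom.intro group_hom_axioms.intro homI simp: BijGroup_def)
  define K where "K = \<psi> ` carrier G"
  have sub: "subgroup K (BijGroup \<Omega>)"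
    unfolding K_def by (rule group_hom.img_is_subgroup[OF hom])
  have K_Bij: "K \<subseteq> Bij \<Omega>"
    unfolding K_def using \<psi>_Bij by auto
  have finK: "finite K"
    unfolding K_def using fin by simp
  have mult: "\<psi> g \<otimes>\<^bsub>BijGroup \<Omega>\<^esub> \<psi> h = \<psi> (g \<otimes> h)" if "g \<in> carrier G" "h \<in> carrier G" for g h
    using that \<psi>_Bij \<psi>_comp by (simp add: BijGroup_def)
  have trans: "transitive_permutation_group \<Omega> K"
    unfolding transitive_permutation_group_def
  proof (intro conjI)
    show "transitive_action (perm_group \<Omega> K) \<Omega> (\<lambda>g. g)"
    proof (intro transitive_action.intro group_action.intro transitive_action_axioms.intro
        group_hom.intro group_hom_axioms.intro homI)
      show "group (perm_group \<Omega> K)"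
        unfolding perm_group_def using subgroup.subgroup_is_group[OF sub group_BijGroup] .
      show "group (BijGroup \<Omega>)" by (rule group_BijGroup)
      show "g \<in> carrier (BijGroup \<Omega>)" if "g \<in> carrier (perm_group \<Omega> K)" for g
        using that K_Bij by (auto simp: perm_group_def BijGroup_def)
      show "\<exists>g\<in>carrier (perm_group \<Omega> K). g a = b" if "a \<in> \<Omega>" "b \<in> \<Omega>" for a b
      proof -
        obtain x where x: "x \<in> carrier G" "a = r x" using r_img \<open>a \<in> \<Omega>\<close> by auto
        obtain y where y: "y \<in> carrier G" "b = r y" using r_img \<open>b \<in> \<Omega>\<close> by auto
        have "\<psi> (y \<otimes> inv x) a = b" using x y by (simp add: \<psi>_r m_assoc)
        then show ?thesis using x y by (auto simp: perm_group_def K_def)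
      qed
    qed (simp add: perm_group_def)
  qed (use sub in \<open>auto simp: \<Omega>_def\<close>)

  \<comment> \<open>The coset \<open>x H\<close> is fixed by \<open>g\<close> iff the conjugate
    \<open>inv x \<otimes> g \<otimes> x\<close> lies in \<open>H\<close>, which is the condition in
    \<open>conj\<close>.\<close>
  have fix_iff: "(\<forall>n\<in>\<Omega>. \<psi> g n \<noteq> n) \<longleftrightarrow> g \<notin> N" if g: "g \<in> carrier G" for g
  proof -
    have "(\<exists>n\<in>\<Omega>. \<psi> g n = n) \<longleftrightarrow> (\<exists>x\<in>carrier G. r x = r (g \<otimes> x))"
      unfolding r_img[symmetric] using g by (auto simp: \<psi>_r) metis+
    also have "\<dots> \<longleftrightarrow> (\<exists>x\<in>carrier G. inv x \<otimes> (g \<otimes> x) \<in> H)"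
      using g by (simp add: r_eq)
    also have "\<dots> \<longleftrightarrow> (\<exists>x\<in>carrier G. \<exists>h\<in>H. g \<otimes> x = x \<otimes> h)"
    proof (intro bex_cong refl)
      fix x assume x: "x \<in> carrier G"
      have "x \<otimes> (inv x \<otimes> y) = y" "inv x \<otimes> (x \<otimes> y) = y" if "y \<in> carrier G" for y
        using x that by (simp_all add: m_assoc [symmetric])
      then show "inv x \<otimes> (g \<otimes> x) \<in> H \<longleftrightarrow> (\<exists>h\<in>H. g \<otimes> x = x \<otimes> h)"
        using g x H.mem_carrier by (auto intro!: bexI[of _ "inv x \<otimes> (g \<otimes> x)"])
    qed
    finally show ?thesis using conj[OF g] by blast
  qed
  have ker: "a \<otimes> inv b \<in> N"
    if a: "a \<in> carrier G" and b: "b \<in> carrier G" and eq: "\<psi> a = \<psi> b" for a b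
  proof -
    have "\<psi> (a \<otimes> inv b) = \<psi> (b \<otimes> inv b)"
      using a b eq by (metis \<psi>_comp inv_closed)
    then have "\<psi> (a \<otimes> inv b) = (\<lambda>n\<in>\<Omega>. n)" using b \<psi>_one by simp
    \<comment> \<open>A point is needed here: on an empty set the identity would be a
      derangement.\<close>
    moreover have "r \<one> \<in> \<Omega>" using r_img by blast
    ultimately show ?thesis using fix_iff[of "a \<otimes> inv b"] a b by auto
  qed

  \<comment> \<open>The partition of the image group by the cosets of \<open>N\<close>\<close>
  have rcoset_iff: "a \<in> C \<longleftrightarrow> C = N #> a"
    if C: "C \<in> rcosets N" and a: "a \<in> carrier G" for a C
  proof
    assume "a \<in> C"
    moreover obtain x where "x \<in> carrier G" "C = N #> x"
      using C unfolding RCOSETS_def by blast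
    ultimately show "C = N #> a" using repr_independence N by simp
  qed (use rcos_self[OF a N] in simp)
  \<comment> \<open>Right cosets fit arcs from \<open>x\<close> to \<open>s \<otimes> x\<close>:
    \<open>N #> a = N #> b\<close> iff \<open>a \<otimes> inv b \<in> N\<close>.\<close>
  define P where "P = (\<lambda>C. \<psi> ` C) ` (rcosets N)"
  \<comment> \<open>Cosets of \<open>N\<close> whose images meet are equal. This gives the
    disjointness of the blocks and also their number, since it makes taking images injective on
    cosets.\<close>
  have coset_unique: "C = D" if C: "C \<in> rcosets N" "a \<in> C" and D: "D \<in> rcosets N" "b \<in> D"
    and eq: "\<psi> a = \<psi> b" for C D a b
  proof -
    have ab: "a \<in> carrier G" "b \<in> carrier G"
      using C D rcosets_part_G[OF N] by blast+
    then have "N #> a = N #> b" using ker eq coset_eq[OF N] by simp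
    then show ?thesis using rcoset_iff ab C D by simp
  qed
  have ne: "C \<noteq> {}" if "C \<in> rcosets N" for C
    using that rcos_self[OF _ N] unfolding RCOSETS_def by auto
  have part: "partition_on K P"
  proof (rule partition_onI)
    show "\<Union>P = K"
      unfolding P_def K_def using rcosets_part_G[OF N] by (metis image_Union)
    show "disjnt B B'" if "B \<in> P" "B' \<in> P" "B \<noteq> B'" for B B'
      using that coset_unique unfolding P_def disjnt_def by blast
    show "{} \<notin> P"
      using ne by (auto simp: P_def)
  qed
  have "inj_on ((`) \<psi>) (rcosets N)"
  proof (rule inj_onI)
    fix C D assume CD: "C \<in> rcosets N" "D \<in> rcosets N" "\<psi> ` C = \<psi> ` D"
    then obtain a where "a \<in> C" using ne by blast
    moreover from this obtain b where "b \<in> D" "\<psi> a = \<psi> b" using CD by blast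
    ultimately show "C = D" using coset_unique CD by blast
  qed
  then have card_P: "card P = card (rcosets N)"
    unfolding P_def by (rule card_image)
  define same where "same u v \<longleftrightarrow> (\<exists>B\<in>P. u \<in> B \<and> v \<in> B)" for u v
  have same_\<psi>: "same (\<psi> a) (\<psi> b) \<longleftrightarrow> a \<otimes> inv b \<in> N"
    if a: "a \<in> carrier G" and b: "b \<in> carrier G" for a b
  proof
    assume "same (\<psi> a) (\<psi> b)"
    then obtain C c d where C: "C \<in> rcosets N" and cd: "c \<in> C" "d \<in> C" "\<psi> a = \<psi> c" "\<psi> b = \<psi> d"
      unfolding same_def P_def by blast
    then have "C = N #> a" "C = N #> b"
      using coset_unique[OF C _ rcosetsI[OF N.subset] rcos_self[OF _ N]] a b by metis+
    then show "a \<otimes> inv b \<in> N" using coset_eq[OF N a b] by simp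
  next
    assume "a \<otimes> inv b \<in> N"
    then have "N #> a = N #> b" using coset_eq[OF N a b] by simp
    then have "a \<in> N #> a" "b \<in> N #> a" using rcos_self a b N by auto
    then show "same (\<psi> a) (\<psi> b)"
      unfolding same_def P_def using rcosetsI[OF N.subset a] by blast
  qed

  \<comment> \<open>Adjacency in the derangement graph\<close>
  have arcs: "parcs (derangement_graph \<Omega> K) = {(u, v). u \<in> K \<and> v \<in> K \<and> \<not> same u v}"
  proof -
    have "(u, v) \<in> parcs (derangement_graph \<Omega> K) \<longleftrightarrow> u \<in> K \<and> v \<in> K \<and> \<not> same u v" for u v
    proof
      assume "(u, v) \<in> parcs (derangement_graph \<Omega> K)"
      then obtain a s where a: "a \<in> carrier G" "u = \<psi> a" and s: "s \<in> carrier G" "\<psi> s \<in> derangements \<Omega> K"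
        and v: "v = \<psi> s \<otimes>\<^bsub>BijGroup \<Omega>\<^esub> \<psi> a"
        by (auto simp: derangement_graph_def cayley_graph_def perm_group_def derangements_def K_def)
      have "s \<notin> N" using s fix_iff by (simp add: derangements_def)
      \<comment> \<open>By \<open>same_\<psi>\<close>, this quotient decides whether the two ends
        share a part; \<open>N\<close> contains \<open>inv s\<close> only if it contains
        \<open>s\<close>.\<close>
      moreover have "a \<otimes> inv (s \<otimes> a) = inv s"
        using a s by (simp add: inv_mult_group m_assoc [symmetric])
      ultimately have "a \<otimes> inv (s \<otimes> a) \<notin> N"
        using s N.m_inv_closed[of "inv s"] by auto
      then show "u \<in> K \<and> v \<in> K \<and> \<not> same u v"
        using a s v by (simp add: mult same_\<psi> K_def)
    next
      assume "u \<in> K \<and> v \<in> K \<and> \<not> same u v"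
      then obtain a b where ab: "a \<in> carrier G" "u = \<psi> a" "b \<in> carrier G" "v = \<psi> b" "a \<otimes> inv b \<notin> N"
        using same_\<psi> by (auto simp: K_def)
      \<comment> \<open>An arc from \<open>\<psi> a\<close> to \<open>\<psi> b\<close> is left
        multiplication by \<open>\<psi> (b \<otimes> inv a)\<close>, which is a derangement because
        the inverse of \<open>b \<otimes> inv a\<close> lies outside \<open>N\<close>.\<close>
      have "inv (b \<otimes> inv a) = a \<otimes> inv b" using ab by (simp add: inv_mult_group)
      then have "b \<otimes> inv a \<notin> N" using ab N.m_inv_closed[of "b \<otimes> inv a"] by auto
      then have "\<psi> (b \<otimes> inv a) \<in> derangements \<Omega> K"
        using ab fix_iff by (simp add: derangements_def K_def)
      moreover have "v = \<psi> (b \<otimes> inv a) \<otimes>\<^bsub>BijGroup \<Omega>\<^esub> u"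
        using ab by (simp add: mult m_assoc)
      ultimately show "(u, v) \<in> parcs (derangement_graph \<Omega> K)"
        using ab by (auto simp: derangement_graph_def cayley_graph_def perm_group_def K_def)
    qed
    then show ?thesis by auto
  qed
  have verts: "pverts (derangement_graph \<Omega> K) = K"
    by (simp add: derangement_graph_def cayley_graph_def perm_group_def)
  \<comment> \<open>Reflexivity of \<open>same\<close> rules out loops.\<close>
  have same_refl: "same u u" if "u \<in> K" for u
    using that partition_onD1[OF part] by (auto simp: same_def)
  have "graph (with_proj (derangement_graph \<Omega> K))"
  proof (rule pair_graph.pair_graphD_graph, unfold_locales)
    show "finite (parcs (derangement_graph \<Omega> K))"
      unfolding arcs by (rule finite_subset[of _ "K \<times> K"]) (auto simp: finK)
    show "symmetric (with_proj (derangement_graph \<Omega> K))"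
      by (auto simp: symmetric_def arcs sym_def same_def)
  qed (use same_refl in \<open>auto simp: arcs verts finK\<close>)
  then have "complete_multipartite (card (rcosets N)) (with_proj (derangement_graph \<Omega> K))"
    unfolding complete_multipartite_def
    using part card_P by (auto simp: arcs verts same_def intro!: exI[of _ P])
  then show ?thesis
    using trans by (auto simp: \<Omega>_def intro!: exI[of _ \<Omega>] exI[of _ K])
qed

section \<open>The Frobenius map and finite fields\<close>

text \<open>Induction by Pascal's rule. The coefficients are natural multiples in the additive
  group, so that characteristic \<open>p\<close> can annihilate them in
  \<open>frobenius_add\<close>.\<close>

lemma (in cring) binomial_expansion:
  assumes x: "x \<in> carrier R" and y: "y \<in> carrier R"
  shows "(x \<oplus> y) [^] (n::nat) = (\<Oplus>k\<in>{..n}. [(n choose k)] \<cdot> (x [^] k \<otimes> y [^] (n - k)))"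
proof (induction n)
  case 0
  then show ?case using assms by simp
next
  case (Suc n)
  let ?t = "\<lambda>n k. x [^] (k::nat) \<otimes> y [^] (n - k)"
  have t: "?t m k \<in> carrier R" for m k :: nat
    using assms by simp
  have tx: "([(n choose k)] \<cdot> ?t n k) \<otimes> x = [(n choose k)] \<cdot> ?t (Suc n) (Suc k)" for k
    using assms by (simp add: add_pow_ldistr add_pow_rdistr m_ac)
  have ty: "([(n choose k)] \<cdot> ?t n k) \<otimes> y = [(n choose k)] \<cdot> ?t (Suc n) k" if "k \<le> n" for k
    using assms that by (simp add: add_pow_ldistr add_pow_rdistr m_ac Suc_diff_le)
  have "(x \<oplus> y) [^] Suc n = (x \<oplus> y) [^] n \<otimes> x \<oplus> (x \<oplus> y) [^] n \<otimes> y"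
    using assms by (simp add: r_distr)
  also have "(x \<oplus> y) [^] n \<otimes> x = (\<Oplus>k\<in>{..n}. [(n choose k)] \<cdot> ?t (Suc n) (Suc k))"
    unfolding Suc.IH using t x by (subst finsum_ldistr) (auto simp: tx intro!: finsum_cong')
  also have "(x \<oplus> y) [^] n \<otimes> y = (\<Oplus>k\<in>{..n}. [(n choose k)] \<cdot> ?t (Suc n) k)"
    unfolding Suc.IH using t y by (subst finsum_ldistr) (auto simp: ty intro!: finsum_cong')
  \<comment> \<open>The added term has coefficient \<open>n choose Suc n = 0\<close>. Splitting off
    the term at 0 and shifting the index then aligns this sum with the one from the factor
    \<open>x\<close>.\<close>
  also have "\<dots> = (\<Oplus>k\<in>{..Suc n}. [(n choose k)] \<cdot> ?t (Suc n) k)"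
    using t assms by (subst finsum_Suc) (auto simp: binomial_eq_0)
  also have "\<dots> = (\<Oplus>k\<in>{..n}. [(n choose Suc k)] \<cdot> ?t (Suc n) (Suc k)) \<oplus> ?t (Suc n) 0"
    using t assms by (subst finsum_Suc2) (auto simp del: diff_Suc_Suc)
  also have "(\<Oplus>k\<in>{..n}. [(n choose k)] \<cdot> ?t (Suc n) (Suc k)) \<oplus> \<dots>
      = ((\<Oplus>k\<in>{..n}. [(n choose k)] \<cdot> ?t (Suc n) (Suc k))
        \<oplus> (\<Oplus>k\<in>{..n}. [(n choose Suc k)] \<cdot> ?t (Suc n) (Suc k))) \<oplus> ?t (Suc n) 0"
    using assms by (intro a_assoc[symmetric] finsum_closed) auto
  also have "\<dots> = (\<Oplus>k\<in>{..n}. [(Suc n choose Suc k)] \<cdot> ?t (Suc n) (Suc k)) \<oplus> ?t (Suc n) 0"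
    using t assms by (subst finsum_addf[symmetric]) (auto simp: add.nat_pow_mult simp del: diff_Suc_Suc)
  also have "\<dots> = (\<Oplus>k\<in>{..Suc n}. [(Suc n choose k)] \<cdot> ?t (Suc n) k)"
    using t assms by (subst finsum_Suc2) (auto simp del: diff_Suc_Suc binomial_Suc_Suc)
  finally show ?case .
qed

text \<open>For exponent \<open>p\<close>, every inner binomial coefficient is divisible by
  \<open>p\<close> and so annihilates its term; only the two end terms survive. Iterating gives the
  exponent \<open>p ^ m\<close>.\<close>

lemma (in cring) frobenius_add:
  fixes p m :: nat
  assumes p: "prime p" "[p] \<cdot> \<one> = \<zero>" and x: "x \<in> carrier R" and y: "y \<in> carrier R"
  shows "(x \<oplus> y) [^] (p ^ m) = x [^] (p ^ m) \<oplus> y [^] (p ^ m)"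
proof (induction m)
  case 0
  then show ?case using assms by simp
next
  case (Suc m)
  have *: "(a \<oplus> b) [^] p = a [^] p \<oplus> b [^] p" if a: "a \<in> carrier R" and b: "b \<in> carrier R" for a b
  proof -
    have zero: "[n] \<cdot> z = \<zero>" if "p dvd n" and z: "z \<in> carrier R" for n z
    proof -
      obtain d where n: "n = p * d" using \<open>p dvd n\<close> by blast
      have "[p] \<cdot> z = ([p] \<cdot> \<one>) \<otimes> z" using z by (simp add: add_pow_ldistr)
      then have "[p] \<cdot> z = \<zero>" using p z by simp
      then show ?thesis
        using z by (simp add: n add.nat_pow_pow [symmetric])
    qed
    have p0: "p > 0" using p prime_gt_0_nat by blast
    let ?f = "\<lambda>k. [(p choose k)] \<cdot> (a [^] k \<otimes> b [^] (p - k))"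
    have f: "?f k \<in> carrier R" for k using a b by simp
    have "(a \<oplus> b) [^] p = (\<Oplus>k\<in>{..p}. ?f k)"
      using a b by (rule binomial_expansion)
    also have "\<dots> = (\<Oplus>k\<in>{0, p}. ?f k)"
    proof (rule add.finprod_mono_neutral_cong_right)
      show "?f k = \<zero>" if "k \<in> {..p} - {0, p}" for k
        using that p(1) a b by (auto intro!: zero dvd_choose_prime)
    qed (use f in auto)
    also have "\<dots> = a [^] p \<oplus> b [^] p"
      using a b p0 by (simp add: a_comm)
    finally show ?thesis .
  qed
  show ?case
    using assms Suc * by (simp add: nat_pow_pow [symmetric] mult.commute[of p])
qed

text \<open>The fixed points are the roots of \<open>X^n - X\<close> with \<open>n = p ^ m\<close>.
  This polynomial splits, so it has \<open>n\<close> roots counted with multiplicity, and every root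
  is simple.\<close>

lemma (in algebraically_closed) card_frobenius_fixed:
  fixes p m :: nat
  assumes p: "prime p" "[p] \<cdot> \<one> = \<zero>" and m: "m > 0"
  shows "card {x \<in> carrier L. x [^] (p ^ m) = x} = p ^ m"
proof -
  define n where "n = p ^ m"
  \<comment> \<open>This bound makes \<open>X^n\<close> the leading term of
    \<open>X^n - X\<close>.\<close>
  have n2: "n \<ge> 2"
    using prime_ge_2_nat[OF p(1)] m self_le_power[of p m] unfolding n_def by linarith
  let ?P = "poly_ring L"
  interpret P: domain ?P
    by (rule univ_poly_is_domain[OF carrier_is_subring])
  interpret const: ring_hom_ring L ?P poly_of_const
    using canonical_embedding_ring_hom[OF carrier_is_subring] by simp
  have X: "X \<in> carrier ?P"
    using var_closed[OF carrier_is_subring] by simp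
  \<comment> \<open>The polynomial ring inherits characteristic \<open>p\<close> through the
    constants, so \<open>frobenius_add\<close> also applies to polynomials.\<close>
  have char: "[p] \<cdot>\<^bsub>?P\<^esub> \<one>\<^bsub>?P\<^esub> = \<zero>\<^bsub>?P\<^esub>"
  proof -
    have "poly_of_const ([k] \<cdot> \<one>) = [k] \<cdot>\<^bsub>?P\<^esub> \<one>\<^bsub>?P\<^esub>" for k :: nat
      by (induction k) simp_all
    then show ?thesis using p(2) by (metis const.hom_zero)
  qed
  have ev: "ring_hom_ring ?P L (\<lambda>f. eval f a)" if "a \<in> carrier L" for a
    by (rule eval_ring_hom[OF carrier_is_subring that])
  define f where "f = X [^]\<^bsub>?P\<^esub> n \<ominus>\<^bsub>?P\<^esub> X"
  have f: "f \<in> carrier ?P"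
    unfolding f_def using X by simp
  have "degree f = n"
  proof -
    have mon: "monom \<one> n = X [^]\<^bsub>?P\<^esub> n"
      by (rule unitary_monom_eq_var_pow[OF carrier_is_subring])
    have degs: "degree (monom \<one> n) = n" "degree (\<ominus>\<^bsub>?P\<^esub> X) = 1"
      using univ_poly_a_inv_degree[OF carrier_is_subring X] by (simp_all add: monom_def var_def)
    have "polynomial (carrier L) (monom \<one> n)" "polynomial (carrier L) (\<ominus>\<^bsub>?P\<^esub> X)"
      unfolding mon univ_poly_carrier using X by simp_all
    from poly_add_degree_eq[OF carrier_is_subring this]
    have "degree (poly_add (monom \<one> n) (\<ominus>\<^bsub>?P\<^esub> X)) = max n 1"
      using degs n2 by simp
    then show ?thesis
      using n2 by (simp add: f_def a_minus_def univ_poly_add mon)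
  qed
  then have size: "size (roots f) = n"
    using roots_over_carrier[OF f] by (simp add: splitted_def)
  have eval_f: "eval f a = a [^] n \<ominus> a" if a: "a \<in> carrier L" for a
  proof -
    interpret ev: ring_hom_ring ?P L "\<lambda>f. eval f a" by (rule ev[OF a])
    show ?thesis
      using X a by (simp add: f_def a_minus_def ev.hom_nat_pow eval_var)
  qed
  have f_ne: "f \<noteq> []"
    using \<open>degree f = n\<close> n2 by auto
  have root_iff: "a \<in># roots f \<longleftrightarrow> a \<in> carrier L \<and> a [^] n = a" for a
    unfolding roots_mem_iff_is_root[OF f] is_root_def using f_ne eval_f
    by (auto simp: r_right_minus_eq)
  \<comment> \<open>With \<open>b = X - a\<close>, the Frobenius map on polynomials gives \<open>X\<^sup>n - X = b\<^sup>n - b = b (b\<^sup>n\<^sup>-\<^sup>1 - 1)\<close>,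
    whose second factor is \<open>-1\<close> at \<open>a\<close>.\<close>
  have simple: "count (roots f) a = 1" if "a \<in># roots f" for a
  proof -
    have a: "a \<in> carrier L" "a [^] n = a" using that root_iff by auto
    interpret ev: ring_hom_ring ?P L "\<lambda>f. eval f a" by (rule ev[OF a(1)])
    define b where "b = [\<one>, \<ominus> a]"
    define c where "c = poly_of_const (\<ominus> a)"
    have c: "c \<in> carrier ?P" unfolding c_def using a by simp
    have b_eq: "b = X \<oplus>\<^bsub>?P\<^esub> c"
      using a by (auto simp: b_def c_def poly_of_const_def var_def univ_poly_add)
    then have b: "b \<in> carrier ?P" using X c by simp
    \<comment> \<open>Additivity of the Frobenius map yields
      \<open>(\<ominus> a) [^] n = \<ominus> a\<close> without distinguishing odd \<open>p\<close>
      from \<open>p = 2\<close>.\<close>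
    have "\<zero> = (a \<oplus> \<ominus> a) [^] n"
      using a n2 by (simp add: r_neg nat_pow_zero)
    also have "\<dots> = a [^] n \<oplus> (\<ominus> a) [^] n"
      unfolding n_def using p a by (intro frobenius_add) auto
    finally have "(\<ominus> a) [^] n = \<ominus> a"
      using a by (metis a_inv_closed minus_equality a_comm nat_pow_closed)
    then have c_pow: "c [^]\<^bsub>?P\<^esub> n = c"
      unfolding c_def using a by (simp add: const.hom_nat_pow [symmetric] del: const.hom_a_inv)
    have b_pow: "b [^]\<^bsub>?P\<^esub> n = X [^]\<^bsub>?P\<^esub> n \<oplus>\<^bsub>?P\<^esub> c"
      using P.frobenius_add[OF p(1) char X c, of m] c_pow by (simp only: b_eq n_def)
    define h where "h = b [^]\<^bsub>?P\<^esub> (n - 1) \<ominus>\<^bsub>?P\<^esub> \<one>\<^bsub>?P\<^esub>"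
    have h: "h \<in> carrier ?P" unfolding h_def using b by simp
    have "b [^]\<^bsub>?P\<^esub> n = b \<otimes>\<^bsub>?P\<^esub> b [^]\<^bsub>?P\<^esub> (n - 1)"
      using P.nat_pow_Suc2[OF b, of "n - 1"] n2 by simp
    then have "b \<otimes>\<^bsub>?P\<^esub> h = b [^]\<^bsub>?P\<^esub> n \<ominus>\<^bsub>?P\<^esub> b"
      unfolding h_def using b by (simp add: a_minus_def P.r_distr P.r_minus)
    also have "\<dots> = f"
    proof -
      have "(Y \<oplus>\<^bsub>?P\<^esub> c) \<ominus>\<^bsub>?P\<^esub> (X \<oplus>\<^bsub>?P\<^esub> c) = Y \<ominus>\<^bsub>?P\<^esub> X" if "Y \<in> carrier ?P" for Y
        using X c that by algebra
      then show ?thesis unfolding b_pow f_def using X by (simp add: b_eq)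
    qed
    finally have f_eq: "f = b \<otimes>\<^bsub>?P\<^esub> h" by simp
    have "eval b a = \<zero>" using a by (simp add: b_def r_neg)
    then have eval_h: "eval h a = \<ominus> \<one>"
      unfolding h_def a_minus_def using a b n2 ev.hom_nat_pow[OF b, of "n - 1"]
      by (simp add: nat_pow_zero)
    then have not_root: "\<not> is_root h a" "h \<noteq> []"
      using a by (auto simp: is_root_def) (metis local.minus_minus minus_zero one_closed zero_not_one)+
    \<comment> \<open>The monic linear factor \<open>b\<close> contributes one copy of
      \<open>a\<close>, and \<open>h\<close> contributes none.\<close>
    have "roots f = add_mset a (roots h)"
      unfolding f_eq b_def using poly_mult_degree_one_monic_imp_same_roots a h not_root by blast
    moreover have "a \<notin># roots h"
      using roots_mem_iff_is_root[OF h] not_root by simp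
    ultimately show ?thesis by (simp add: not_in_iff)
  qed
  have "n = (\<Sum>a\<in>set_mset (roots f). count (roots f) a)"
    using size by (simp add: size_multiset_overloaded_eq)
  also have "\<dots> = card (set_mset (roots f))"
    using simple by simp
  also have "set_mset (roots f) = {x \<in> carrier L. x [^] n = x}"
    using root_iff by auto
  finally show ?thesis by (simp add: n_def)
qed

text \<open>The power map is additive and multiplicative, so its fixed points are closed under the
  field operations. For negatives, additivity is applied to
  \<open>\<ominus> x \<oplus> x = \<zero>\<close>.\<close>

lemma (in field) subfield_frobenius_fixed:
  fixes p m :: nat
  assumes p: "prime p" "[p] \<cdot> \<one> = \<zero>"
  shows "subfield {x \<in> carrier R. x [^] (p ^ m) = x} R"
proof -
  let ?q = "p ^ m" and ?K = "{x \<in> carrier R. x [^] (p ^ m) = x}"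
  have q0: "?q \<noteq> 0" using p prime_gt_0_nat by simp
  have minus: "(\<ominus> x) [^] ?q = \<ominus> (x [^] ?q)" if x: "x \<in> carrier R" for x
  proof -
    have "(\<ominus> x) [^] ?q \<oplus> x [^] ?q = (\<ominus> x \<oplus> x) [^] ?q"
      using p x by (intro frobenius_add[symmetric]) auto
    also have "\<dots> = \<zero>" using x q0 by (simp add: l_neg nat_pow_zero)
    finally show ?thesis using x by (metis a_inv_closed minus_equality nat_pow_closed)
  qed
  show ?thesis
  proof (intro subfieldI' subringI)
    show "\<ominus> x \<in> ?K" if "x \<in> ?K" for x
      using that minus by auto
    show "x \<otimes> y \<in> ?K" if "x \<in> ?K" "y \<in> ?K" for x y
      using that by (auto simp: nat_pow_distrib)
    show "x \<oplus> y \<in> ?K" if "x \<in> ?K" "y \<in> ?K" for x y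
      using that by (auto simp: frobenius_add[OF p])
    show "inv x \<in> ?K" if "x \<in> ?K - {\<zero>}" for x
    proof -
      have x: "x \<in> carrier R" "inv x \<in> carrier R" "x \<otimes> inv x = \<one>" "x [^] ?q = x"
        using that field_Units by auto
      then have "x \<otimes> (inv x) [^] ?q = \<one>"
        using nat_pow_distrib[of x "inv x" ?q] by simp
      then have "inv x = (inv x) [^] ?q"
        using x by (intro comm_inv_char) auto
      then show ?thesis using x by simp
    qed
  qed auto
qed

text \<open>Inside an algebraic closure of the integers modulo \<open>p\<close>, with
  \<open>q = p ^ k\<close>, take the solutions of \<open>x^(q^2) = x\<close> for \<open>R\<close>
  and those of \<open>x^q = x\<close> for \<open>K\<close>. The element type is the one on which
  \<open>alg_closure\<close> builds the closure of a ring of integers.\<close>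

lemma exists_quadratic_field_extension:
  fixes p k :: nat
  assumes p: "prime p" and k: "k \<ge> 1"
  obtains R :: "((int list \<times> nat) multiset \<Rightarrow> int) ring" and K
  where "field R" "subfield K R" "card (carrier R) = (p ^ k) ^ 2" "card K = p ^ k"
proof -
  interpret F: residues_prime p "residue_ring (int p)"
    by (simp add: residues_prime_def p)
  define L where "L = F.alg_closure"
  define h :: "int \<Rightarrow> (int list \<times> nat) multiset \<Rightarrow> int" where "h = F.indexed_const"
  interpret L: algebraic_closure L "h ` carrier (residue_ring (int p))"
    unfolding L_def h_def by (rule F.alg_closureE(1))
  interpret h: ring_hom_ring "residue_ring (int p)" L h
    using F.alg_closureE(2) F.ring_axioms L.ring_axioms
    by (auto simp: L_def h_def intro: ring_hom_ringI2)
  have "[n] \<cdot>\<^bsub>residue_ring (int p)\<^esub> \<one>\<^bsub>residue_ring (int p)\<^esub> = int n mod int p" for n :: nat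
    by (induction n) (simp_all add: F.res_zero_eq F.res_one_eq F.res_add_eq mod_simps ac_simps)
  moreover have "h ([n] \<cdot>\<^bsub>residue_ring (int p)\<^esub> \<one>\<^bsub>residue_ring (int p)\<^esub>) = [n] \<cdot>\<^bsub>L\<^esub> \<one>\<^bsub>L\<^esub>" for n :: nat
    by (induction n) simp_all
  ultimately have char: "[p] \<cdot>\<^bsub>L\<^esub> \<one>\<^bsub>L\<^esub> = \<zero>\<^bsub>L\<^esub>"
    by (metis F.res_zero_eq h.hom_zero mod_self)
  define Fix where "Fix n = {x \<in> carrier L. x [^]\<^bsub>L\<^esub> n = x}" for n :: nat
  have sub: "subfield (Fix (p ^ m)) L" for m
    unfolding Fix_def by (rule L.subfield_frobenius_fixed[OF p char])
  have card: "card (Fix (p ^ m)) = p ^ m" if "m > 0" for m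
    unfolding Fix_def by (rule L.card_frobenius_fixed[OF p char that])
  define R where "R = L\<lparr>carrier := Fix (p ^ (k * 2))\<rparr>"
  have fR: "field R"
    unfolding R_def by (rule L.subfield_iff(2)[OF sub])
  \<comment> \<open>If \<open>x^q = x\<close>, then \<open>x^(q^2) = (x^q)^q = x\<close>.\<close>
  have "Fix (p ^ k) \<subseteq> carrier R"
    by (auto simp: R_def Fix_def power_mult power2_eq_square L.nat_pow_pow [symmetric])
  \<comment> \<open>The second carrier update overrides the first, so this record is
    \<open>L\<close> restricted to \<open>Fix (p ^ k)\<close>.\<close>
  moreover have "field (R\<lparr>carrier := Fix (p ^ k)\<rparr>)"
    unfolding R_def using L.subfield_iff(2)[OF sub[of k]] by simp
  ultimately have "subfield (Fix (p ^ k)) R"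
    using ring.subfield_iff(1)[OF field.is_ring[OF fR]] by blast
  moreover have card_R: "card (carrier R) = (p ^ k) ^ 2"
    using card[of "k * 2"] k by (simp add: R_def power_mult)
  ultimately show thesis
    using that[OF fR] card_R card[of k] k by simp
qed

section \<open>The affine group of a field\<close>

text \<open>The pair \<open>(a, b)\<close> stands for the map sending \<open>x\<close> to \<open>a x + b\<close>.\<close>

definition affine_group :: "('a, 'm) ring_scheme \<Rightarrow> ('a \<times> 'a) monoid" where
  "affine_group R = \<lparr>carrier = (carrier R - {\<zero>\<^bsub>R\<^esub>}) \<times> carrier R,
     monoid.mult = \<lambda>(a, b) (c, d). (a \<otimes>\<^bsub>R\<^esub> c, a \<otimes>\<^bsub>R\<^esub> d \<oplus>\<^bsub>R\<^esub> b),
     one = (\<one>\<^bsub>R\<^esub>, \<zero>\<^bsub>R\<^esub>)\<rparr>"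

lemma affine_group_simps [simp]:
  "carrier (affine_group R) = (carrier R - {\<zero>\<^bsub>R\<^esub>}) \<times> carrier R"
  "(a, b) \<otimes>\<^bsub>affine_group R\<^esub> (c, d) = (a \<otimes>\<^bsub>R\<^esub> c, a \<otimes>\<^bsub>R\<^esub> d \<oplus>\<^bsub>R\<^esub> b)"
  "\<one>\<^bsub>affine_group R\<^esub> = (\<one>\<^bsub>R\<^esub>, \<zero>\<^bsub>R\<^esub>)"
  by (simp_all add: affine_group_def)

context field
begin

lemma inv_nonzero:
  assumes "a \<in> carrier R" "a \<noteq> \<zero>"
  shows "inv a \<in> carrier R" "inv a \<noteq> \<zero>" "inv a \<otimes> a = \<one>" "a \<otimes> inv a = \<one>"
proof -
  have a: "a \<in> Units R" using assms field_Units by simp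
  then show "inv a \<in> carrier R" "inv a \<otimes> a = \<one>" "a \<otimes> inv a = \<one>" by simp_all
  show "inv a \<noteq> \<zero>" using Units_inv_Units[OF a] field_Units by simp
qed

lemma affine_group_l_inv:
  assumes "a \<in> carrier R" "a \<noteq> \<zero>" "b \<in> carrier R"
  shows "(inv a, \<ominus> (inv a \<otimes> b)) \<otimes>\<^bsub>affine_group R\<^esub> (a, b) = \<one>\<^bsub>affine_group R\<^esub>"
  using assms inv_nonzero[OF assms(1,2)] by (simp add: r_neg)

lemma group_affine_group: "group (affine_group R)"
proof (rule groupI)
  fix x y z assume "x \<in> carrier (affine_group R)" "y \<in> carrier (affine_group R)" "z \<in> carrier (affine_group R)"
  then show "x \<otimes>\<^bsub>affine_group R\<^esub> y \<otimes>\<^bsub>affine_group R\<^esub> z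
      = x \<otimes>\<^bsub>affine_group R\<^esub> (y \<otimes>\<^bsub>affine_group R\<^esub> z)"
    by (auto simp: m_assoc r_distr a_assoc)
next
  fix x assume "x \<in> carrier (affine_group R)"
  then obtain a b where x: "x = (a, b)" "a \<in> carrier R" "a \<noteq> \<zero>" "b \<in> carrier R" by auto
  show "\<exists>y\<in>carrier (affine_group R). y \<otimes>\<^bsub>affine_group R\<^esub> x = \<one>\<^bsub>affine_group R\<^esub>"
    using x inv_nonzero[OF x(2,3)] affine_group_l_inv[OF x(2-4)]
    by (intro bexI[of _ "(inv a, \<ominus> (inv a \<otimes> b))"]) simp_all
qed (auto simp: integral_iff)

lemma inv_affine_group:
  assumes "a \<in> carrier R" "a \<noteq> \<zero>" "b \<in> carrier R"
  shows "inv\<^bsub>affine_group R\<^esub> (a, b) = (inv a, \<ominus> (inv a \<otimes> b))"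
  using assms inv_nonzero[OF assms(1,2)] affine_group_l_inv[OF assms]
  by (intro group.inv_equality[OF group_affine_group]) simp_all

text \<open>Serves for both subgroups in the main proof: \<open>B = K\<close> gives the stabilizer
  of the line \<open>K\<close>, and \<open>B = carrier R\<close> gives the group of all elements
  that are not derangements. Closure of \<open>B\<close> under scaling by \<open>K\<close> keeps the
  translation parts \<open>a \<otimes> d \<oplus> b\<close> and
  \<open>\<ominus> (inv a \<otimes> b)\<close> in \<open>B\<close>.\<close>

lemma subgroup_affine_group:
  assumes K: "subfield K R" and B: "subgroup B (add_monoid R)"
    and scale: "\<And>a b. a \<in> K \<Longrightarrow> b \<in> B \<Longrightarrow> a \<otimes> b \<in> B"
  shows "subgroup ((K - {\<zero>}) \<times> B) (affine_group R)"
proof (rule group.subgroupI[OF group_affine_group])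
  note K_sub = subfieldE(3)[OF K]
  have B_sub: "B \<subseteq> carrier R" using subgroup.subset[OF B] by simp
  show "(K - {\<zero>}) \<times> B \<subseteq> carrier (affine_group R)"
    using K_sub B_sub by auto
  show "(K - {\<zero>}) \<times> B \<noteq> {}"
    using subgroup.one_closed[OF B] subringE(3)[OF subfieldE(1)[OF K]] by auto
  fix x assume "x \<in> (K - {\<zero>}) \<times> B"
  then obtain a b where x: "x = (a, b)" "a \<in> K" "a \<noteq> \<zero>" "b \<in> B" by auto
  have ia: "inv a \<in> K" using subfield_m_inv(1)[OF K] x by auto
  then have "\<ominus> (inv a \<otimes> b) \<in> B"
    using subgroup.m_inv_closed[OF B scale[OF ia x(4)]] by (simp add: a_inv_def)
  then show "inv\<^bsub>affine_group R\<^esub> x \<in> (K - {\<zero>}) \<times> B"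
    using x ia K_sub B_sub inv_nonzero[of a] by (auto simp: inv_affine_group subset_iff)
  fix y assume "y \<in> (K - {\<zero>}) \<times> B"
  then obtain c d where y: "y = (c, d)" "c \<in> K" "c \<noteq> \<zero>" "d \<in> B" by auto
  have "a \<otimes> c \<in> K" "a \<otimes> c \<noteq> \<zero>"
    using x y K_sub subringE(6)[OF subfieldE(1)[OF K]] by (auto simp: integral_iff subset_iff)
  moreover have "a \<otimes> d \<oplus> b \<in> B"
    using subgroup.m_closed[OF B scale[OF x(2) y(4)] x(4)] by simp
  ultimately show "x \<otimes>\<^bsub>affine_group R\<^esub> y \<in> (K - {\<zero>}) \<times> B"
    using x y by simp
qed

text \<open>This is the hypothesis \<open>conj\<close> of the coset action lemma. Conjugation
  preserves the linear part because multiplication in \<open>R\<close> commutes, which gives one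
  direction. Conversely, a map with linear part in \<open>K\<close> is conjugate to a linear map or
  to the translation by 1, both in the affine group of \<open>K\<close>.\<close>

lemma affine_group_conjugate_iff:
  assumes K: "subfield K R" and g: "g \<in> carrier (affine_group R)"
  shows "g \<in> (K - {\<zero>}) \<times> carrier R \<longleftrightarrow>
    (\<exists>x\<in>carrier (affine_group R). \<exists>h\<in>(K - {\<zero>}) \<times> K. g \<otimes>\<^bsub>affine_group R\<^esub> x = x \<otimes>\<^bsub>affine_group R\<^esub> h)"
proof -
  note K_sub = subfieldE(3)[OF K]
  have K0: "\<zero> \<in> K" and K1: "\<one> \<in> K"
    using subringE(2,3)[OF subfieldE(1)[OF K]] by auto
  obtain a b where ab: "g = (a, b)" "a \<in> carrier R" "a \<noteq> \<zero>" "b \<in> carrier R" using g by auto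
  show ?thesis
  proof
    assume "\<exists>x\<in>carrier (affine_group R). \<exists>h\<in>(K - {\<zero>}) \<times> K. g \<otimes>\<^bsub>affine_group R\<^esub> x = x \<otimes>\<^bsub>affine_group R\<^esub> h"
    then obtain c a' where c: "c \<in> carrier R" "c \<noteq> \<zero>" "a' \<in> K" "a \<otimes> c = c \<otimes> a'"
      using ab by auto
    moreover have "a' \<in> carrier R" using c K_sub by auto
    ultimately have "a = a'" using m_lcancel[of c a a'] ab by (simp add: m_comm)
    then show "g \<in> (K - {\<zero>}) \<times> carrier R" using ab c by simp
  next
    assume "g \<in> (K - {\<zero>}) \<times> carrier R"
    then have a: "a \<in> K" using ab by simp
    consider "a \<noteq> \<one>" | "a = \<one>" "b = \<zero>" | "a = \<one>" "b \<noteq> \<zero>" by blast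
    then show "\<exists>x\<in>carrier (affine_group R). \<exists>h\<in>(K - {\<zero>}) \<times> K. g \<otimes>\<^bsub>affine_group R\<^esub> x = x \<otimes>\<^bsub>affine_group R\<^esub> h"
    proof cases
      case 1
      \<comment> \<open>The fixed point \<open>b / (1 - a)\<close> of the map; translation by
        \<open>d\<close> conjugates it to multiplication by \<open>a\<close>.\<close>
      define d where "d = inv (\<one> \<ominus> a) \<otimes> b"
      have "\<one> \<ominus> a \<noteq> \<zero>" using 1 ab by (simp add: r_right_minus_eq)
      then have u: "inv (\<one> \<ominus> a) \<in> carrier R" "(\<one> \<ominus> a) \<otimes> inv (\<one> \<ominus> a) = \<one>"
        using inv_nonzero[of "\<one> \<ominus> a"] ab by auto
      have d: "d \<in> carrier R" unfolding d_def using u ab by simp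
      have "(\<one> \<ominus> a) \<otimes> d = b"
        unfolding d_def using u ab by (simp add: m_assoc [symmetric])
      then have "a \<otimes> d \<oplus> b = a \<otimes> d \<oplus> (\<one> \<ominus> a) \<otimes> d" by simp
      also have "\<dots> = d"
        using d ab(2) by algebra
      finally have "a \<otimes> d \<oplus> b = d" .
      then show ?thesis
        using ab d a K0
        by (intro bexI[of _ "(\<one>, d)"] bexI[of _ "(a, \<zero>)"]) auto
    next
      case 2
      then show ?thesis
        using ab K0 K1 by (intro bexI[of _ "(\<one>, \<zero>)"] bexI[of _ "(\<one>, \<zero>)"]) auto
    next
      \<comment> \<open>Scaling by \<open>b\<close> conjugates the translation by \<open>b\<close>
        to the translation by 1.\<close>
      case 3
      then show ?thesis
        using ab K1 by (intro bexI[of _ "(b, \<zero>)"] bexI[of _ "(\<one>, \<one>)"]) auto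
    qed
  qed
qed

end

section \<open>Orders and indices in the affine group over the field of order
  \<open>q^2\<close>\<close>

theorem theorem1p5:
  fixes p k q :: nat
  assumes "prime p" and "k \<ge> 1" and "q = p ^ k"
  shows "\<exists>(\<Omega> :: nat set) H. transitive_permutation_group \<Omega> H \<and> card \<Omega> = q * (q + 1) \<and>
           complete_multipartite (q + 1) (with_proj (derangement_graph \<Omega> H))"
proof -
  obtain R :: "((int list \<times> nat) multiset \<Rightarrow> int) ring" and K
    where R: "field R" and K: "subfield K R" and cR: "card (carrier R) = q ^ 2" and cK: "card K = q"
    using exists_quadratic_field_extension[OF assms(1,2)] assms(3) by metis
  interpret field R by (rule R)
  let ?G = "affine_group R" and ?H = "(K - {\<zero>\<^bsub>R\<^esub>}) \<times> K" and ?N = "(K - {\<zero>\<^bsub>R\<^esub>}) \<times> carrier R"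
  interpret G: group ?G by (rule group_affine_group)
  \<comment> \<open>Positive cardinality yields finiteness of \<open>R\<close> and \<open>K\<close>,
    since \<open>card\<close> is 0 on infinite sets; \<open>q - 1 \<noteq> 0\<close> allows the
    cancellation after Lagrange's theorem.\<close>
  have q: "q \<ge> 2"
    using prime_ge_2_nat[OF assms(1)] assms(2,3) self_le_power[of p k] by simp
  have fin: "finite (carrier R)" "finite K"
    using cR cK q by (auto intro: card_ge_0_finite)
  have zero: "\<zero>\<^bsub>R\<^esub> \<in> K"
    using subringE(2)[OF subfieldE(1)[OF K]] .
  have H: "subgroup ?H ?G"
    using subring.axioms(1)[OF subfieldE(1)[OF K]] subringE(6)[OF subfieldE(1)[OF K]]
    by (intro subgroup_affine_group K) auto
  have N: "subgroup ?N ?G"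
    using add.subgroup_self subfieldE(3)[OF K] by (intro subgroup_affine_group K) auto
  have "q ^ 2 - 1 = (q + 1) * (q - 1)"
    by (simp add: power2_eq_square algebra_simps diff_mult_distrib2)
  then have ord: "order ?G = (q + 1) * (q - 1) * q ^ 2"
    using fin by (simp add: order_def card_cartesian_product cR)
  have finG: "finite (carrier ?G)" using fin by simp
  have "card ?H = (q - 1) * q" "card ?N = (q - 1) * q ^ 2"
    using fin zero by (simp_all add: card_cartesian_product cK cR)
  \<comment> \<open>Lagrange's theorem, with \<open>order ?G\<close> regrouped so that the order of
    each subgroup is a common factor to cancel.\<close>
  then have "card (rcosets\<^bsub>?G\<^esub> ?H) * ((q - 1) * q) = (q * (q + 1)) * ((q - 1) * q)"
    and "card (rcosets\<^bsub>?G\<^esub> ?N) * ((q - 1) * q ^ 2) = (q + 1) * ((q - 1) * q ^ 2)"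
    using G.lagrange_finite[OF finG H] G.lagrange_finite[OF finG N]
    by (simp_all only: ord power2_eq_square ac_simps)
  moreover have "(q - 1) * q \<noteq> 0" "(q - 1) * q ^ 2 \<noteq> 0"
    using q by simp_all
  ultimately have cH: "card (rcosets\<^bsub>?G\<^esub> ?H) = q * (q + 1)" and cN: "card (rcosets\<^bsub>?G\<^esub> ?N) = q + 1"
    by (simp_all only: mult_cancel_right simp_thms)
  show ?thesis
    using G.coset_action_complete_multipartite[OF finG H N affine_group_conjugate_iff[OF K]]
    unfolding cH cN .
qed

end
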